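(* At each vertex $u_i$ and each time step $n\ge1$, the first step of the frame update (defined in the context) is a rotation that maps $\tilde{\boldsymbol{\tau}}_h^{n-1}(u_i)$ to $\tilde{\boldsymbol{\tau}}_h^{n}(u_i)$, and the second step is a rotation about the new tangent $\tilde{\boldsymbol{\tau}}_h^{n}(u_i)$, leaving $\tilde{\boldsymbol{\tau}}_h^{n}(u_i)$ unaffected. Since the same rotations are applied to the two frame vectors, and these rotations map $\tilde{\boldsymbol{\tau}}_h^{n-1}(u_i)$ to $\tilde{\boldsymbol{\tau}}_h^{n}(u_i)$, the update procedure preserves the frame orthogonality conditions at each vertex: writing $\boldsymbol{e}_h^{0,k}=\tilde{\boldsymbol{\tau}}_h^{k}$, if $\boldsymbol{e}_h^{j_1,n-1}(u_i)\cdot\boldsymbol{e}_h^{j_2,n-1}(u_i)=\delta_{j_1,j_2}$ for all $j_1,j_2\in\{0,1,2\}$, then $\boldsymbol{e}_h^{j_1,n}(u_i)\cdot\boldsymbol{e}_h^{j_2,n}(u_i)=\delta_{j_1,j_2}$ for all $j_1,j_2\in\{0,1,2\}$.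
   Context: Let $0=u_1<\dots<u_N=1$ be a mesh, let $V_h$ be the space of continuous functions on $[0,1]$ that are affine on each $[u_i,u_{i+1}]$, and let $\Delta t>0$ be the time step. Let $\boldsymbol{x}_h^{n-1},\boldsymbol{x}_h^n\in V_h^3$ be the discrete midline curves at two consecutive time steps, and let $m_h^n\in V_h$ be the (real-valued) discrete tangential angular velocity at time step $n$. For $k=n-1,n$ let $\boldsymbol{\tau}_h^k=\boldsymbol{x}_{h,u}^k/|\boldsymbol{x}_{h,u}^k|$ be the piecewise constant unit tangent (the subscript $u$ denotes the derivative in $u\in[0,1]$), and let $\tilde{\boldsymbol{\tau}}_h^k\in V_h^3$ have vertex values $\tilde{\boldsymbol{\tau}}_h^k(u_i)=\dfrac{\boldsymbol{\tau}_h^k(u_i^-)+\boldsymbol{\tau}_h^k(u_i^+)}{|\boldsymbol{\tau}_h^k(u_i^-)+\boldsymbol{\tau}_h^k(u_i^+)|}$ for $i=1,\dots,N$, where $u_i^\pm$ refers to the element to the right ($+$) or left ($-$) of $u_i$ (only the one adjacent element being used at the end points). Frame update: given frame vectors $\boldsymbol{e}_h^{1,n-1},\boldsymbol{e}_h^{2,n-1}\in V_h^3$, set $\boldsymbol{k}_i^n=\tilde{\boldsymbol{\tau}}_h^{n-1}(u_i)\times\tilde{\boldsymbol{\tau}}_h^n(u_i)$, $\boldsymbol{l}_i^n=\tilde{\boldsymbol{\tau}}_h^n(u_i)$, $\varphi_i^n=\Delta t\,m_h^n(u_i)$. For $j=1,2$ and each vertex, the new frame vectors $\boldsymbol{e}_h^{j,n}\in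 V_h^3$ are defined by applying the Rodrigues formula twice. First step: $$\tilde{\boldsymbol{e}}^{j,n}_h(u_i)=\boldsymbol{e}^{j,n-1}_h(u_i)\bigl(\tilde{\boldsymbol{\tau}}_h^{n-1}(u_i)\cdot\tilde{\boldsymbol{\tau}}_h^n(u_i)\bigr)+\boldsymbol{k}_i^n\times\boldsymbol{e}^{j,n-1}_h(u_i)+\bigl(\boldsymbol{e}^{j,n-1}_h(u_i)\cdot\boldsymbol{k}_i^n\bigr)\boldsymbol{k}_i^n\,\frac{1}{1+\tilde{\boldsymbol{\tau}}_h^{n-1}(u_i)\cdot\tilde{\boldsymbol{\tau}}_h^n(u_i)}.$$ Second step: $$\boldsymbol{e}^{j,n}_h(u_i)=\tilde{\boldsymbol{e}}^{j,n}_h(u_i)\cos\varphi_i^n+\boldsymbol{l}_i^n\times\tilde{\boldsymbol{e}}^{j,n}_h(u_i)\sin\varphi_i^n+\bigl(\tilde{\boldsymbol{e}}^{j,n}_h(u_i)\cdot\boldsymbol{l}_i^n\bigr)\boldsymbol{l}_i^n(1-\cos\varphi_i^n).$$ Each step is regarded as the linear map of $\mathbb{R}^3$ given by the same formula with an arbitrary vector in place of the frame vector. All operations are in exact arithmetic. *)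

theory Defs
  imports "HOL-Analysis.Analysis"
begin

definition is_mesh :: "nat \<Rightarrow> (nat \<Rightarrow> real) \<Rightarrow> bool" where
  "is_mesh N u \<longleftrightarrow> 2 \<le> N \<and> u 1 = 0 \<and> u N = 1 \<and> strict_mono_on {1..N} u"

(* Functions on [0,1] are total functions on the reals whose values outside [0,1] are irrelevant:
   nothing below depends on them. *)

definition Vh :: "nat \<Rightarrow> (nat \<Rightarrow> real) \<Rightarrow> (real \<Rightarrow> real) set" where
  "Vh N u = {f. continuous_on {0..1} f \<and>
     (\<forall>i\<in>{1..<N}. \<exists>a b. \<forall>s\<in>{u i..u (Suc i)}. f s = a + b * s)}"

definition Vh3 :: "nat \<Rightarrow> (nat \<Rightarrow> real) \<Rightarrow> (real \<Rightarrow> real^3) set" where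
  "Vh3 N u = {f. \<forall>c. (\<lambda>s. f s $ c) \<in> Vh N u}"

definition regular_curve :: "nat \<Rightarrow> (nat \<Rightarrow> real) \<Rightarrow> (real \<Rightarrow> real^3) \<Rightarrow> bool" where
  "regular_curve N u x \<longleftrightarrow>
     (\<forall>i\<in>{1..<N}. \<forall>s\<in>{u i<..<u (Suc i)}. vector_derivative x (at s) \<noteq> 0)"

(* sgn v = v / |v| (and sgn 0 = 0) *)
definition tangent :: "(real \<Rightarrow> real^3) \<Rightarrow> real \<Rightarrow> real^3" where
  "tangent x s = sgn (vector_derivative x (at s))"

definition tangent_left :: "(real \<Rightarrow> real^3) \<Rightarrow> real \<Rightarrow> real^3" where
  "tangent_left x s = Lim (at_left s) (tangent x)"

definition tangent_right :: "(real \<Rightarrow> real^3) \<Rightarrow> real \<Rightarrow> real^3" where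
  "tangent_right x s = Lim (at_right s) (tangent x)"

definition vertex_tangent_sum ::
  "nat \<Rightarrow> (nat \<Rightarrow> real) \<Rightarrow> (real \<Rightarrow> real^3) \<Rightarrow> nat \<Rightarrow> real^3" where
  "vertex_tangent_sum N u x i =
     (if i = 1 then tangent_right x (u i)
      else if i = N then tangent_left x (u i)
      else tangent_left x (u i) + tangent_right x (u i))"

(* Vertex values determine an element of Vh3 on [0,1], so this characterises tt there. *)
definition is_vertex_tangent ::
  "nat \<Rightarrow> (nat \<Rightarrow> real) \<Rightarrow> (real \<Rightarrow> real^3) \<Rightarrow> (real \<Rightarrow> real^3) \<Rightarrow> bool" where
  "is_vertex_tangent N u x tt \<longleftrightarrow>
     tt \<in> Vh3 N u \<and> (\<forall>i\<in>{1..N}. tt (u i) = sgn (vertex_tangent_sum N u x i))"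

definition first_step :: "real^3 \<Rightarrow> real^3 \<Rightarrow> real^3 \<Rightarrow> real^3" where
  "first_step t0 t1 v =
     (let k = cross3 t0 t1
      in (t0 \<bullet> t1) *\<^sub>R v + cross3 k v + ((v \<bullet> k) * (1 / (1 + t0 \<bullet> t1))) *\<^sub>R k)"

definition second_step :: "real^3 \<Rightarrow> real \<Rightarrow> real^3 \<Rightarrow> real^3" where
  "second_step l \<phi> v =
     cos \<phi> *\<^sub>R v + sin \<phi> *\<^sub>R cross3 l v + ((v \<bullet> l) * (1 - cos \<phi>)) *\<^sub>R l"

(* tt0, tt1: vertex tangents at the old and the new time step; e0, e1: one frame vector at the
   old and the new time step. *)
definition frame_update ::
  "nat \<Rightarrow> (nat \<Rightarrow> real) \<Rightarrow> real \<Rightarrow> (real \<Rightarrow> real^3) \<Rightarrow> (real \<Rightarrow> real^3) \<Rightarrow> (real \<Rightarrow> real)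
     \<Rightarrow> (real \<Rightarrow> real^3) \<Rightarrow> (real \<Rightarrow> real^3) \<Rightarrow> bool" where
  "frame_update N u dt tt0 tt1 m e0 e1 \<longleftrightarrow>
     e0 \<in> Vh3 N u \<and> e1 \<in> Vh3 N u \<and>
     (\<forall>i\<in>{1..N}. e1 (u i) =
        second_step (tt1 (u i)) (dt * m (u i)) (first_step (tt0 (u i)) (tt1 (u i)) (e0 (u i))))"

definition rotation :: "(real^3 \<Rightarrow> real^3) \<Rightarrow> bool" where
  "rotation f \<longleftrightarrow> linear f \<and> rotation_matrix (matrix f)"

definition rotation_about :: "real^3 \<Rightarrow> (real^3 \<Rightarrow> real^3) \<Rightarrow> bool" where
  "rotation_about l f \<longleftrightarrow> l \<noteq> 0 \<and> rotation f \<and> (\<forall>p\<in>span {l}. f p = p)"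

(* The vertex tangent as zeroth frame vector. *)
definition full_frame ::
  "(nat \<Rightarrow> real \<Rightarrow> real^3) \<Rightarrow> (nat \<Rightarrow> nat \<Rightarrow> real \<Rightarrow> real^3) \<Rightarrow> nat \<Rightarrow> nat \<Rightarrow> real \<Rightarrow> real^3" where
  "full_frame tt e j k = (if j = 0 then tt k else e j k)"

definition orthonormal_at ::
  "(nat \<Rightarrow> nat \<Rightarrow> real \<Rightarrow> real^3) \<Rightarrow> nat \<Rightarrow> real \<Rightarrow> bool" where
  "orthonormal_at E k s \<longleftrightarrow>
     (\<forall>j1\<in>{0,1,2}. \<forall>j2\<in>{0,1,2}. E j1 k s \<bullet> E j2 k s = (if j1 = j2 then 1 else 0))"

end

theory Submission
  imports Defs
begin

text \<open>
  Both steps of the frame update have the form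
  \<open>v \<mapsto> c v + s (a \<times> v) + d (v \<bullet> a) a\<close>. Such a map multiplies the axis \<open>a\<close> by
  \<open>c + d |a|\<^sup>2\<close> and acts on the plane orthogonal to \<open>a\<close> as the scaled rotation with complex
  multiplier \<open>c + \<i> s |a|\<close>. Hence it is a rotation as soon as \<open>c\<^sup>2 + s\<^sup>2 |a|\<^sup>2 = 1\<close> and
  \<open>c + d |a|\<^sup>2 = 1\<close> (\<open>rotation_axial_map\<close>). For unit tangents \<open>t0\<close>, \<open>t1\<close> the first step
  satisfies these equations with \<open>a = t0 \<times> t1\<close> and \<open>c = t0 \<bullet> t1\<close>, by the Lagrange identity
  \<open>|t0 \<times> t1|\<^sup>2 = 1 - (t0 \<bullet> t1)\<^sup>2\<close>; the second satisfies them with \<open>a = t1\<close>, by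
  \<open>cos\<^sup>2 + sin\<^sup>2 = 1\<close>. A rotation preserves inner products, and the composite of the two steps
  carries the old tangent and frame vectors to the new ones, so orthonormality is inherited.

  The unit length of the vertex tangents is where the geometry of the curves enters
  (\<open>norm_vertex_tangent\<close>): they are normalised vectors, so it is enough that the vector being
  normalised is nonzero. At interior vertices this is assumed. At the two end points it is the
  one-sided limit of the tangent, which equals the constant tangent of the adjacent element and
  is nonzero because the curve is regular.
\<close>

section \<open>Rotations of Rodrigues type\<close>

text \<open>The coefficients are kept independent of each other so that a single map covers both steps.
  The second step would not fit if \<open>s\<close> were absorbed into \<open>a\<close>, since the axis
  would be lost when the sine of the angle vanishes.\<close>

definition axial_map :: "real \<Rightarrow> real \<Rightarrow> real \<Rightarrow> real^3 \<Rightarrow> real^3 \<Rightarrow> real^3" where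
  "axial_map c s d a v = c *\<^sub>R v + s *\<^sub>R cross3 a v + (d * (v \<bullet> a)) *\<^sub>R a"

lemma linear_axial_map: "linear (axial_map c s d a)"
  by (rule linearI)
     (simp_all add: axial_map_def cross3_simps algebra_simps inner_add_left inner_add_right)

lemma axial_map_inner:
  assumes "c\<^sup>2 + s\<^sup>2 * (a \<bullet> a) = 1" and "c + d * (a \<bullet> a) = 1"
  shows "axial_map c s d a v \<bullet> axial_map c s d a w = v \<bullet> w"
proof -
  have triple: "v \<bullet> cross3 a w + cross3 a v \<bullet> w = 0"
    "cross3 a v \<bullet> a = 0" "a \<bullet> cross3 a w = 0"
    by (simp_all add: cross3_simps inner_vec_def sum_3)
  have lagrange: "cross3 a v \<bullet> cross3 a w = (a \<bullet> a) * (v \<bullet> w) - (v \<bullet> a) * (w \<bullet> a)"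
    by (simp add: cross3_simps inner_vec_def sum_3)
  have "axial_map c s d a v \<bullet> axial_map c s d a w
      = c\<^sup>2 * (v \<bullet> w) + s\<^sup>2 * (cross3 a v \<bullet> cross3 a w) + c * s * (v \<bullet> cross3 a w + cross3 a v \<bullet> w)
        + (2 * c * d + d\<^sup>2 * (a \<bullet> a)) * (v \<bullet> a) * (w \<bullet> a)
        + s * d * (w \<bullet> a) * (cross3 a v \<bullet> a) + s * d * (v \<bullet> a) * (a \<bullet> cross3 a w)"
    by (simp add: axial_map_def inner_add_left inner_add_right inner_commute
        power2_eq_square algebra_simps)
  also have "\<dots> = (c\<^sup>2 + s\<^sup>2 * (a \<bullet> a)) * (v \<bullet> w)
      + (2 * c * d + d * (d * (a \<bullet> a)) - s\<^sup>2) * ((v \<bullet> a) * (w \<bullet> a))"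
    unfolding triple lagrange by (simp add: algebra_simps power2_eq_square)
  also have "\<dots> = v \<bullet> w"
  proof (cases "a = 0")
    case True
    then show ?thesis using assms(1) by simp
  next
    case False
    have "d * (a \<bullet> a) = 1 - c" using assms(2) by simp
    \<comment> \<open>The conditions give \<open>d (1 + c) |a|\<^sup>2 = 1 - c\<^sup>2 = s\<^sup>2 |a|\<^sup>2\<close>.\<close>
    moreover have "s\<^sup>2 * (a \<bullet> a) = (1 - c) * (1 + c)"
      using assms(1) by (simp add: algebra_simps power2_eq_square)
    ultimately have "(2 * c * d + d * (d * (a \<bullet> a)) - s\<^sup>2) * (a \<bullet> a) = 0"
      by algebra
    then have "2 * c * d + d * (d * (a \<bullet> a)) - s\<^sup>2 = 0"
      using False by simp
    then show ?thesis using assms(1) by simp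
  qed
  finally show ?thesis .
qed

text \<open>The factors are the eigenvalue on the axis and the determinant of the restriction to the
  plane orthogonal to it.\<close>

lemma det_axial_map:
  "det (matrix (axial_map c s d a)) = (c + d * (a \<bullet> a)) * (c\<^sup>2 + s\<^sup>2 * (a \<bullet> a))"
  by (simp add: det_3 matrix_def axial_map_def cross3_def axis_def inner_vec_def sum_3
      algebra_simps power2_eq_square)

lemma rotation_axial_map:
  assumes "c\<^sup>2 + s\<^sup>2 * (a \<bullet> a) = 1" and "c + d * (a \<bullet> a) = 1"
  shows "rotation (axial_map c s d a)"
proof -
  have "orthogonal_transformation (axial_map c s d a)"
    unfolding orthogonal_transformation_def
    using linear_axial_map axial_map_inner[OF assms] by blast
  then have "orthogonal_matrix (matrix (axial_map c s d a))"
    using orthogonal_transformation_matrix by blast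
  moreover have "det (matrix (axial_map c s d a)) = 1"
    by (simp add: det_axial_map assms)
  ultimately show ?thesis
    unfolding rotation_def rotation_matrix_def using linear_axial_map by blast
qed

lemma rotation_inner:
  assumes "rotation f"
  shows "f v \<bullet> f w = v \<bullet> w"
proof -
  have "orthogonal_transformation f"
    using assms orthogonal_transformation_matrix unfolding rotation_def rotation_matrix_def by blast
  then show ?thesis unfolding orthogonal_transformation_def by blast
qed

section \<open>The two steps of the frame update\<close>

lemma rotation_first_step:
  assumes "norm t0 = 1" and "norm t1 = 1" and "1 + t0 \<bullet> t1 \<noteq> 0"
  shows "rotation (first_step t0 t1)"
proof -
  let ?c = "t0 \<bullet> t1" and ?k = "cross3 t0 t1"
  have k: "?k \<bullet> ?k = (1 - ?c) * (1 + ?c)"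
    using norm_cross_dot[of t0 t1] assms(1,2)
    by (simp add: power2_norm_eq_inner) (simp add: power2_eq_square algebra_simps)
  have "first_step t0 t1 = axial_map ?c 1 (1 / (1 + ?c)) ?k"
    by (rule ext) (simp add: first_step_def axial_map_def Let_def)
  moreover have "?c\<^sup>2 + 1\<^sup>2 * (?k \<bullet> ?k) = 1"
    unfolding k by (simp add: algebra_simps power2_eq_square)
  moreover have "?c + 1 / (1 + ?c) * (?k \<bullet> ?k) = 1"
    unfolding k using assms(3) by simp
  ultimately show ?thesis using rotation_axial_map by simp
qed

lemma first_step_maps_tangent:
  assumes "norm t0 = 1"
  shows "first_step t0 t1 t0 = t1"
proof -
  have "t0 \<bullet> t0 = 1" using assms by (simp add: norm_eq_1)
  moreover have "cross3 (cross3 t0 t1) t0 = (t0 \<bullet> t0) *\<^sub>R t1 - (t0 \<bullet> t1) *\<^sub>R t0"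
    by (simp add: cross3_simps inner_vec_def sum_3 vec_eq_iff forall_3)
  moreover have "t0 \<bullet> cross3 t0 t1 = 0"
    by (simp add: dot_cross_self)
  ultimately show ?thesis
    by (simp add: first_step_def Let_def)
qed

lemma rotation_second_step:
  assumes "norm l = 1"
  shows "rotation (second_step l \<phi>)"
proof -
  have l: "l \<bullet> l = 1" using assms by (simp add: norm_eq_1)
  have "second_step l \<phi> = axial_map (cos \<phi>) (sin \<phi>) (1 - cos \<phi>) l"
    by (rule ext) (simp add: second_step_def axial_map_def mult.commute)
  moreover have "(cos \<phi>)\<^sup>2 + (sin \<phi>)\<^sup>2 * (l \<bullet> l) = 1"
    by (simp add: l)
  moreover have "cos \<phi> + (1 - cos \<phi>) * (l \<bullet> l) = 1"
    by (simp add: l)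
  ultimately show ?thesis using rotation_axial_map by simp
qed

lemma second_step_fixes_axis:
  assumes "norm l = 1"
  shows "second_step l \<phi> l = l"
proof -
  have "l \<bullet> l = 1" using assms by (simp add: norm_eq_1)
  then show ?thesis by (simp add: second_step_def cross_refl algebra_simps)
qed

lemma rotation_about_second_step:
  assumes "norm l = 1"
  shows "rotation_about l (second_step l \<phi>)"
proof -
  have "linear (second_step l \<phi>)"
    using rotation_second_step[OF assms] unfolding rotation_def by blast
  then have "second_step l \<phi> p = p" if "p \<in> span {l}" for p
    using that second_step_fixes_axis[OF assms]
    by (auto simp: span_singleton linear_cmul)
  moreover have "l \<noteq> 0" using assms by auto
  ultimately show ?thesis
    unfolding rotation_about_def using rotation_second_step[OF assms] by blast
qed

section \<open>Vertex tangents are unit vectors\<close>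

lemma Vh3_affine:
  assumes "x \<in> Vh3 N u" and "i \<in> {1..<N}"
  obtains a b where "\<And>s. s \<in> {u i..u (Suc i)} \<Longrightarrow> x s = a + s *\<^sub>R b"
proof -
  have "\<forall>c. \<exists>a b. \<forall>s\<in>{u i..u (Suc i)}. x s $ c = a + b * s"
    using assms unfolding Vh3_def Vh_def by blast
  then obtain a b where "\<forall>c. \<forall>s\<in>{u i..u (Suc i)}. x s $ c = a c + b c * s"
    by metis
  then have "x s = (\<chi> c. a c) + s *\<^sub>R (\<chi> c. b c)" if "s \<in> {u i..u (Suc i)}" for s
    using that by (simp add: vec_eq_iff mult.commute)
  then show ?thesis using that by blast
qed

lemma tangent_constant_on_element:
  assumes "x \<in> Vh3 N u" and "regular_curve N u x" and "i \<in> {1..<N}" and "u i < u (Suc i)"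
  obtains b where "b \<noteq> 0" and "\<And>s. s \<in> {u i<..<u (Suc i)} \<Longrightarrow> tangent x s = b"
proof -
  obtain a b where x: "\<And>s. s \<in> {u i..u (Suc i)} \<Longrightarrow> x s = a + s *\<^sub>R b"
    using Vh3_affine assms(1,3) by blast
  have deriv: "vector_derivative x (at s) = b" if s: "s \<in> {u i<..<u (Suc i)}" for s
  proof (rule vector_derivative_at)
    have "((\<lambda>s. a + s *\<^sub>R b) has_vector_derivative b) (at s)"
      by (auto intro!: derivative_eq_intros)
    moreover have "a + r *\<^sub>R b = x r" if "r \<in> {u i<..<u (Suc i)}" for r
      using x that by simp
    ultimately show "(x has_vector_derivative b) (at s)"
      using has_vector_derivative_transform_within_open[OF _ open_greaterThanLessThan s]
      by blast
  qed
  obtain r where r: "r \<in> {u i<..<u (Suc i)}"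
    using dense[OF assms(4)] by auto
  have "b \<noteq> 0"
    using assms(2,3) deriv[OF r] r unfolding regular_curve_def by blast
  then have "sgn b \<noteq> 0" by (simp add: sgn_zero_iff)
  then show ?thesis using that[of "sgn b"] deriv by (simp add: tangent_def)
qed

lemma tangent_right_nonzero:
  assumes "x \<in> Vh3 N u" and "regular_curve N u x" and "i \<in> {1..<N}" and "u i < u (Suc i)"
  shows "tangent_right x (u i) \<noteq> 0"
proof -
  obtain b where b: "b \<noteq> 0" "\<And>s. s \<in> {u i<..<u (Suc i)} \<Longrightarrow> tangent x s = b"
    using tangent_constant_on_element[OF assms] by blast
  have "eventually (\<lambda>s. tangent x s = b) (at_right (u i))"
    using eventually_at_right_real[OF assms(4)] by eventually_elim (use b in blast)
  then have "(tangent x \<longlongrightarrow> b) (at_right (u i))"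
    by (rule tendsto_eventually)
  then have "tangent_right x (u i) = b"
    unfolding tangent_right_def by (intro tendsto_Lim) simp_all
  then show ?thesis using b by simp
qed

lemma tangent_left_nonzero:
  assumes "x \<in> Vh3 N u" and "regular_curve N u x" and "i \<in> {1..<N}" and "u i < u (Suc i)"
  shows "tangent_left x (u (Suc i)) \<noteq> 0"
proof -
  obtain b where b: "b \<noteq> 0" "\<And>s. s \<in> {u i<..<u (Suc i)} \<Longrightarrow> tangent x s = b"
    using tangent_constant_on_element[OF assms] by blast
  have "eventually (\<lambda>s. tangent x s = b) (at_left (u (Suc i)))"
    using eventually_at_left_real[OF assms(4)] by eventually_elim (use b in blast)
  then have "(tangent x \<longlongrightarrow> b) (at_left (u (Suc i)))"
    by (rule tendsto_eventually)
  then have "tangent_left x (u (Suc i)) = b"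
    unfolding tangent_left_def by (intro tendsto_Lim) simp_all
  then show ?thesis using b by simp
qed

lemma norm_vertex_tangent:
  assumes mesh: "is_mesh N u" and x: "x \<in> Vh3 N u" "regular_curve N u x"
    and interior: "\<forall>i\<in>{2..<N}. vertex_tangent_sum N u x i \<noteq> 0"
    and t: "is_vertex_tangent N u x t" and i: "i \<in> {1..N}"
  shows "norm (t (u i)) = 1"
proof -
  have N: "2 \<le> N" and mono: "strict_mono_on {1..N} u"
    using mesh by (simp_all add: is_mesh_def)
  have step: "u j < u (Suc j)" if "j \<in> {1..<N}" for j
    using strict_mono_onD[OF mono, of j "Suc j"] that by simp
  have "vertex_tangent_sum N u x i \<noteq> 0"
  proof -
    consider "i = 1" | "i = N" | "i \<in> {2..<N}"
      using i by fastforce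
    then show ?thesis
    proof cases
      case 1
      have "tangent_right x (u 1) \<noteq> 0"
        using tangent_right_nonzero[OF x _ step, of 1] N by simp
      then show ?thesis using 1 by (simp add: vertex_tangent_sum_def)
    next
      case 2
      have "tangent_left x (u (Suc (N - 1))) \<noteq> 0"
        using tangent_left_nonzero[OF x _ step, of "N - 1"] N by simp
      then show ?thesis using 2 N by (simp add: vertex_tangent_sum_def)
    next
      case 3
      then show ?thesis using interior by blast
    qed
  qed
  moreover have "t (u i) = sgn (vertex_tangent_sum N u x i)"
    using t i by (simp add: is_vertex_tangent_def)
  ultimately show ?thesis by (simp add: norm_sgn)
qed

section \<open>Orthonormality of the updated frame\<close>

theorem mainTheorem3:
  fixes N n :: nat and u :: "nat \<Rightarrow> real" and dt :: real
    and x :: "nat \<Rightarrow> real \<Rightarrow> real^3" and m :: "nat \<Rightarrow> real \<Rightarrow> real"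
    and tt :: "nat \<Rightarrow> real \<Rightarrow> real^3" and e :: "nat \<Rightarrow> nat \<Rightarrow> real \<Rightarrow> real^3"
  assumes "is_mesh N u" and "dt > 0" and "n \<ge> 1"
    and "\<forall>k\<in>{n - 1, n}. x k \<in> Vh3 N u"
    and "\<forall>k\<in>{n - 1, n}. regular_curve N u (x k)"
    and "m n \<in> Vh N u"
    and "\<forall>k\<in>{n - 1, n}. \<forall>i\<in>{2..<N}. vertex_tangent_sum N u (x k) i \<noteq> 0"
    and "\<forall>k\<in>{n - 1, n}. is_vertex_tangent N u (x k) (tt k)"
    and "\<forall>i\<in>{1..N}. 1 + tt (n - 1) (u i) \<bullet> tt n (u i) \<noteq> 0"
    and "\<forall>j\<in>{1, 2}. frame_update N u dt (tt (n - 1)) (tt n) (m n) (e j (n - 1)) (e j n)"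
  shows "\<forall>i\<in>{1..N}.
      (let R1 = first_step (tt (n - 1) (u i)) (tt n (u i));
           R2 = second_step (tt n (u i)) (dt * m n (u i))
       in rotation R1 \<and> R1 (tt (n - 1) (u i)) = tt n (u i) \<and>
          rotation_about (tt n (u i)) R2 \<and> R2 (tt n (u i)) = tt n (u i) \<and>
          R2 (R1 (tt (n - 1) (u i))) = tt n (u i) \<and>
          (orthonormal_at (full_frame tt e) (n - 1) (u i) \<longrightarrow>
           orthonormal_at (full_frame tt e) n (u i)))"
proof
  fix i assume i: "i \<in> {1..N}"
  let ?t0 = "tt (n - 1) (u i)" and ?t1 = "tt n (u i)"
  let ?R1 = "first_step ?t0 ?t1" and ?R2 = "second_step ?t1 (dt * m n (u i))"
  have norm: "norm (tt k (u i)) = 1" if "k \<in> {n - 1, n}" for k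
    using norm_vertex_tangent[OF assms(1), of "x k" "tt k" i] assms(4,5,7,8) i that by blast
  have R1: "rotation ?R1"
    using rotation_first_step norm assms(9) i by simp
  have R1t: "?R1 ?t0 = ?t1"
    using first_step_maps_tangent norm by simp
  have R2: "rotation_about ?t1 ?R2"
    using rotation_about_second_step norm by simp
  have R2t: "?R2 ?t1 = ?t1"
    using second_step_fixes_axis norm by simp
  have isometry: "?R2 (?R1 v) \<bullet> ?R2 (?R1 w) = v \<bullet> w" for v w
    using rotation_inner R1 R2 unfolding rotation_about_def by simp
  have update: "full_frame tt e j n (u i) = ?R2 (?R1 (full_frame tt e j (n - 1) (u i)))"
    if "j \<in> {0, 1, 2}" for j
  proof (cases "j = 0")
    case True
    then show ?thesis using R1t R2t by (simp add: full_frame_def)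
  next
    case False
    then have "frame_update N u dt (tt (n - 1)) (tt n) (m n) (e j (n - 1)) (e j n)"
      using assms(10) that by blast
    then show ?thesis using False i by (simp add: full_frame_def frame_update_def)
  qed
  have "orthonormal_at (full_frame tt e) n (u i)"
    if "orthonormal_at (full_frame tt e) (n - 1) (u i)"
    using that unfolding orthonormal_at_def by (simp add: update isometry del: One_nat_def)
  then show "let R1 = ?R1; R2 = ?R2
       in rotation R1 \<and> R1 ?t0 = ?t1 \<and> rotation_about ?t1 R2 \<and> R2 ?t1 = ?t1 \<and>
          R2 (R1 ?t0) = ?t1 \<and>
          (orthonormal_at (full_frame tt e) (n - 1) (u i) \<longrightarrow>
           orthonormal_at (full_frame tt e) n (u i))"
    using R1 R1t R2 R2t by (simp add: Let_def)
qed

end
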